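(* Let $f\in\mathbb{Q}[x]$ be a non-constant square-free polynomial and let $[a,b]$, with $a<b$ and $ab>0$, be a closed interval belonging to a monotonic convex isolation of $f$. Let $\xi$ be the only real root of $f$ in $[a,b]$. Consider the following two-stage iteration (the iteration of Algorithm LZ2). Stage 1. Put $(x,\gamma_0)=(a,b)$ if $f(a)f''(a)>0$, and $(x,\gamma_0)=(b,a)$ otherwise. For $j=0,1,2,\ldots$ let $z_j=\gamma_j-\dfrac{f(\gamma_j)}{f'(\gamma_j)}$; if $z_j\in[a,b]$, stop and set $c_0=\gamma_j$; otherwise set $$\gamma_{j+1}=\frac{x f(\gamma_j)-\gamma_j f(x)}{f(\gamma_j)-f(x)}$$ and continue with $j+1$. Stage 2. Set $x_0=x$ and, for $i=0,1,2,\ldots$, $$x_{i+1}=c_i-\frac{f(c_i)}{f'(c_i)},\qquad c_{i+1}=\frac{c_i f(x_{i+1})-x_{i+1}f(c_i)}{f(x_{i+1})-f(c_i)}.$$ Then this iteration converges (to $\xi$), and its convergence rate is at least $3$.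
   Context: A real root isolation of a square-free polynomial $f$ is a finite collection of pairwise disjoint closed intervals with rational endpoints (degenerate point intervals $[r,r]$ are allowed) such that each interval contains exactly one real root of $f$ and every real root of $f$ lies in one of the intervals. A real root isolation $Iso$ of a square-free polynomial $f\in\mathbb{Q}[x]$ is called a monotonic convex isolation of $f$ if, for every $I\in Iso$ that is not a point, $f'(x)\neq 0$ and $f''(x)\neq 0$ for all $x\in I$. Algorithm LZ2 takes $[a,b]$ and a positive integer $L$ and refines $[a,b]$ to a narrow interval containing $\xi$ by running the stated iteration, the intervals having as endpoints the current values of $x$ and $c$; it stops once the current values satisfy $|x-c|\le 10^{-L}\min(|x|,|c|)$. The statement concerns the iteration continued indefinitely. Convergence of the iteration means that Stage 1 stops after finitely many steps and that in Stage 2 $x_i\to\xi$ and $c_i\to\xi$. The convergence rate is that of the interval lengths $\ell_i=|x_i-c_i|$ in Stage 2: rate at least $p$ means that $\ell_i\to 0$ and there is a constant $C$ with $\ell_{i+1}\le C\,\ell_i^{\,p}$ for all sufficiently large $i$. *)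

theory Defs
  imports "HOL-Computational_Algebra.Computational_Algebra"
begin

abbreviation real_poly :: "rat poly \<Rightarrow> real poly" where
  "real_poly f \<equiv> map_poly of_rat f"

abbreviation rat_interval :: "rat \<times> rat \<Rightarrow> real set" where
  "rat_interval I \<equiv> {real_of_rat (fst I) .. real_of_rat (snd I)}"

text \<open>A collection of closed intervals with rational endpoints is represented by the set of its
  endpoint pairs; pairs with equal components are the point intervals.\<close>

definition real_root_isolation :: "rat poly \<Rightarrow> (rat \<times> rat) set \<Rightarrow> bool" where
  "real_root_isolation f Iso \<longleftrightarrow>
     finite Iso \<and>
     (\<forall>I\<in>Iso. fst I \<le> snd I) \<and>
     pairwise (\<lambda>I J. disjnt (rat_interval I) (rat_interval J)) Iso \<and>
     (\<forall>I\<in>Iso. \<exists>!r. r \<in> rat_interval I \<and> poly (real_poly f) r = 0) \<and>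
     (\<forall>r. poly (real_poly f) r = 0 \<longrightarrow> (\<exists>I\<in>Iso. r \<in> rat_interval I))"

definition monotonic_convex_isolation :: "rat poly \<Rightarrow> (rat \<times> rat) set \<Rightarrow> bool" where
  "monotonic_convex_isolation f Iso \<longleftrightarrow>
     real_root_isolation f Iso \<and>
     (\<forall>I\<in>Iso. fst I < snd I \<longrightarrow>
        (\<forall>x\<in>rat_interval I. poly (pderiv (real_poly f)) x \<noteq> 0 \<and>
                           poly (pderiv (pderiv (real_poly f))) x \<noteq> 0))"

definition newton_step :: "real poly \<Rightarrow> real \<Rightarrow> real" where
  "newton_step p c = c - poly p c / poly (pderiv p) c"

text \<open>For \<open>u = v\<close> the secant quotient is undefined. In the iteration this happens only
  when an endpoint of the initial interval is itself the root, so that the iteration lands exactly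
  on the root: then \<open>u = v\<close> is the root, the quotient reads 0/0, and the current interval
  has length zero. The convention is that the iteration then stays at this point.\<close>

definition secant_step :: "real poly \<Rightarrow> real \<Rightarrow> real \<Rightarrow> real" where
  "secant_step p u v =
     (if u = v then u else (u * poly p v - v * poly p u) / (poly p v - poly p u))"

definition lz2_start :: "real poly \<Rightarrow> real \<Rightarrow> real \<Rightarrow> real \<times> real" where
  "lz2_start p a b = (if poly p a * poly (pderiv (pderiv p)) a > 0 then (a, b) else (b, a))"

text \<open>The sequence \<open>lz2_gamma\<close> is not cut off when Stage 1 stops; its later members
  are not used.\<close>

primrec lz2_gamma :: "real poly \<Rightarrow> real \<Rightarrow> real \<Rightarrow> nat \<Rightarrow> real" where
  "lz2_gamma p a b 0 = snd (lz2_start p a b)"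
| "lz2_gamma p a b (Suc j) = secant_step p (fst (lz2_start p a b)) (lz2_gamma p a b j)"

definition lz2_stage1_stop :: "real poly \<Rightarrow> real \<Rightarrow> real \<Rightarrow> nat \<Rightarrow> bool" where
  "lz2_stage1_stop p a b j \<longleftrightarrow> newton_step p (lz2_gamma p a b j) \<in> {a..b}"

text \<open>The pair \<open>(x\<^sub>i, c\<^sub>i)\<close> of Stage 2. It is meaningful only if Stage 1 stops.\<close>

primrec lz2_stage2 :: "real poly \<Rightarrow> real \<Rightarrow> real \<Rightarrow> nat \<Rightarrow> real \<times> real" where
  "lz2_stage2 p a b 0 =
     (fst (lz2_start p a b), lz2_gamma p a b (LEAST j. lz2_stage1_stop p a b j))"
| "lz2_stage2 p a b (Suc i) =
     (let c = snd (lz2_stage2 p a b i); x' = newton_step p c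
      in (x', secant_step p c x'))"

definition lz2_x :: "real poly \<Rightarrow> real \<Rightarrow> real \<Rightarrow> nat \<Rightarrow> real" where
  "lz2_x p a b i = fst (lz2_stage2 p a b i)"

definition lz2_c :: "real poly \<Rightarrow> real \<Rightarrow> real \<Rightarrow> nat \<Rightarrow> real" where
  "lz2_c p a b i = snd (lz2_stage2 p a b i)"

definition lz2_converges_to :: "real poly \<Rightarrow> real \<Rightarrow> real \<Rightarrow> real \<Rightarrow> bool" where
  "lz2_converges_to p a b \<xi> \<longleftrightarrow>
     (\<exists>j. lz2_stage1_stop p a b j) \<and>
     lz2_x p a b \<longlonglongrightarrow> \<xi> \<and> lz2_c p a b \<longlonglongrightarrow> \<xi>"

definition convergence_rate_at_least :: "(nat \<Rightarrow> real) \<Rightarrow> real \<Rightarrow> bool" where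
  "convergence_rate_at_least l p \<longleftrightarrow>
     l \<longlonglongrightarrow> 0 \<and> (\<exists>C. \<forall>\<^sub>F i in sequentially. l (Suc i) \<le> C * l i powr p)"

end

(* Only the signs of p' and p'' on the interval matter. An affine change of variable t = s (x - \<xi>)
   with s = 1 or s = -1, together with a change of sign of p, reduces to an increasing convex function
   q with root 0 on an interval [\<alpha>, \<beta>] with \<alpha> \<le> 0 \<le> \<beta>, where x runs on the right of 0 and c on the left.
   A secant step u \<mapsto> S u v contracts the distance |u| by a fixed factor, which gives termination of
   Stage 1 and convergence of Stage 2. For the rate, a Newton step satisfies N c \<asymp> c^2 from above and
   from below (the lower bound needs q'' > 0), and a secant step satisfies |S u v| = O(|u| v). Hence
   x_{i+1} = O(c_i^2) = O(c_{i-1}^2 x_i^2) = O(x_i^3), and |c_{i+1}| = O(x_{i+1}). *)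
theory Submission
  imports Defs
begin

section \<open>Newton and secant steps for an increasing convex function\<close>

text \<open>\<open>q'\<close> is tied to \<open>q\<close> only by the two-sided quadratic bound on
  the tangent error, so \<open>k\<close> and \<open>K\<close> play the part of bounds on half the
  second derivative. The secant equation is cleared of its denominator; as u \<le> 0 \<le> v, it
  leaves \<open>S\<close> undetermined only at u = v = 0, where \<open>secant_root\<close> fixes the
  value.\<close>

locale newton_secant =
  fixes q q' :: "real \<Rightarrow> real" and S :: "real \<Rightarrow> real \<Rightarrow> real" and \<alpha> \<beta> m M k K :: real
  assumes root: "q 0 = 0"
    and dom: "\<alpha> \<le> 0" "0 \<le> \<beta>"
    and pos: "0 < m" "0 < k"
    and slope: "\<And>t. t \<in> {\<alpha>..\<beta>} \<Longrightarrow> m \<le> q' t \<and> q' t \<le> M"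
    and curvature: "\<And>u w. u \<in> {\<alpha>..\<beta>} \<Longrightarrow> w \<in> {\<alpha>..\<beta>} \<Longrightarrow>
           k * (w - u)\<^sup>2 \<le> q w - q u - q' u * (w - u) \<and> q w - q u - q' u * (w - u) \<le> K * (w - u)\<^sup>2"
    and k_le_K: "k \<le> K"
    and secant: "\<And>u v. u \<in> {\<alpha>..0} \<Longrightarrow> v \<in> {0..\<beta>} \<Longrightarrow> S u v * (q v - q u) = u * q v - v * q u"
    and secant_root: "S 0 0 = 0"
begin

section \<open>Estimates for single Newton and secant steps\<close>

definition N :: "real \<Rightarrow> real" where
  "N c = c - q c / q' c"

lemma m_le_M: "m \<le> M"
  using slope[of 0] dom by auto

lemma consts_pos: "0 < M" "0 < K"
  using m_le_M pos k_le_K by auto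

lemma tangent:
  assumes "u \<in> {\<alpha>..\<beta>}" "w \<in> {\<alpha>..\<beta>}"
  shows "q u + q' u * (w - u) \<le> q w"
proof -
  have "0 \<le> k * (w - u)\<^sup>2" using pos by simp
  then show ?thesis using curvature[OF assms] by linarith
qed

text \<open>The tangent inequality at \<open>u\<close> gives the lower bound, the one at
  \<open>w\<close> the upper bound.\<close>

lemma increment_bounds:
  assumes "u \<in> {\<alpha>..\<beta>}" "w \<in> {\<alpha>..\<beta>}" "u \<le> w"
  shows "m * (w - u) \<le> q w - q u" "q w - q u \<le> M * (w - u)"
proof -
  have "m * (w - u) \<le> q' u * (w - u)"
    using slope[of u] assms by (intro mult_right_mono) auto
  then show "m * (w - u) \<le> q w - q u" using tangent[OF assms(1,2)] by linarith
  have "q' w * (w - u) \<le> M * (w - u)"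
    using slope[of w] assms by (intro mult_right_mono) auto
  then show "q w - q u \<le> M * (w - u)"
    using tangent[OF assms(2,1)] by (simp add: algebra_simps)
qed

text \<open>Adding the tangent inequalities at \<open>u\<close> and at \<open>w\<close> cancels the
  values of \<open>q\<close>.\<close>

lemma slope_mono:
  assumes "u \<in> {\<alpha>..\<beta>}" "w \<in> {\<alpha>..\<beta>}" "u \<le> w"
  shows "q' u \<le> q' w"
proof (cases "u = w")
  case False
  have "(q' w - q' u) * (w - u) \<ge> 0"
    using tangent[OF assms(1,2)] tangent[OF assms(2,1)] by (simp add: algebra_simps)
  then show ?thesis using False assms(3) by (simp add: zero_le_mult_iff)
qed simp

text \<open>Since q(0) = 0, the product \<open>q' c * N c\<close> is exactly the error at 0 of the
  tangent at \<open>c\<close>, which \<open>curvature\<close> controls on both sides. The bound from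
  below later allows the square of c to be replaced by a multiple of the next x.\<close>

lemma newton_bounds:
  assumes c: "c \<in> {\<alpha>..0}"
  shows "0 \<le> N c" "k * c\<^sup>2 \<le> M * N c" "m * N c \<le> K * c\<^sup>2"
proof -
  have dc: "c \<in> {\<alpha>..\<beta>}" "0 \<in> {\<alpha>..\<beta>}" using c dom by auto
  have s: "m \<le> q' c" "q' c \<le> M" using slope[OF dc(1)] by auto
  with pos have p: "0 < q' c" by linarith
  have e: "q' c * N c = q 0 - q c - q' c * (0 - c)"
    unfolding N_def using p root by (simp add: field_simps)
  have b: "k * c\<^sup>2 \<le> q' c * N c" "q' c * N c \<le> K * c\<^sup>2"
    unfolding e using curvature[OF dc] by auto
  have "0 \<le> k * c\<^sup>2" using pos by simp
  then show nn: "0 \<le> N c" using b(1) p by (metis order_trans zero_le_mult_iff not_less)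
  show "k * c\<^sup>2 \<le> M * N c" using b(1) mult_right_mono[OF s(2) nn] by linarith
  show "m * N c \<le> K * c\<^sup>2" using b(2) mult_right_mono[OF s(1) nn] by linarith
qed

text \<open>The tangent at \<open>c'\<close> is nonnegative at the zero \<open>N c\<close> of the tangent at \<open>c\<close>.\<close>

lemma newton_antimono:
  assumes "c \<in> {\<alpha>..0}" "c' \<in> {\<alpha>..0}" "c \<le> c'"
  shows "N c' \<le> N c"
proof -
  have d: "c \<in> {\<alpha>..\<beta>}" "c' \<in> {\<alpha>..\<beta>}" using assms dom by auto
  have p: "0 < q' c" "0 < q' c'" using slope d pos by (metis less_le_trans)+
  have "q' c * (N c - c') \<le> q' c' * (N c - c')"
    using slope_mono[OF d assms(3)] newton_bounds(1)[OF assms(1)] assms(2)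
    by (intro mult_right_mono) auto
  moreover have "q c + q' c * (c' - c) \<le> q c'" by (rule tangent[OF d])
  moreover have "q' c * N c = q' c * c - q c"
    unfolding N_def using p by (simp add: field_simps)
  moreover have "q' c' * N c' = q' c' * c' - q c'"
    unfolding N_def using p by (simp add: field_simps)
  ultimately have "q' c' * N c' \<le> q' c' * N c" by (simp add: algebra_simps)
  then show ?thesis using p by simp
qed

text \<open>For u < v the secant equation is used in two forms. Solved for the progress
  \<open>S u v - u\<close>, it gives the contraction; written with the errors of \<open>q\<close>
  against its tangent at 0, it gives the sign and the product bound.\<close>

lemma secant_bounds:
  assumes u: "u \<in> {\<alpha>..0}" and v: "v \<in> {0..\<beta>}"
  shows "S u v \<in> {u..0}" "m * - S u v \<le> K * - u * v" "- S u v \<le> (1 - m / M) * - u"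
proof -
  have "S u v \<in> {u..0} \<and> m * - S u v \<le> K * - u * v \<and> - S u v \<le> (1 - m / M) * - u"
  proof (cases "u = v")
    case True
    then show ?thesis using u v secant_root by auto
  next
    case False
    with u v have l: "0 < v - u" by auto
    have d: "u \<in> {\<alpha>..\<beta>}" "v \<in> {\<alpha>..\<beta>}" "0 \<in> {\<alpha>..\<beta>}" using u v dom by auto
    define D where "D = q v - q u"
    have D: "m * (v - u) \<le> D" "D \<le> M * (v - u)"
      unfolding D_def using increment_bounds[OF d(1,2)] u v by auto
    have "0 < m * (v - u)" using l pos by simp
    with D have Dp: "0 < D" by linarith
    have qu: "m * - u \<le> - q u" using increment_bounds(1)[OF d(1,3)] u root by auto
    have low: "m * - u * (v - u) \<le> (S u v - u) * D"
    proof -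
      have "(S u v - u) * D = - q u * (v - u)"
        using secant[OF u v] by (simp add: D_def algebra_simps)
      then show ?thesis using mult_right_mono[OF qu, of "v - u"] l by simp
    qed
    \<comment> \<open>A linear term contributes nothing to u q(v) - v q(u), so \<open>q\<close> may
      be replaced there by its quadratic error \<open>R\<close>.\<close>
    define R where "R t = q t - q' 0 * t" for t
    have R: "0 \<le> R t" "R t \<le> K * t\<^sup>2" if "t \<in> {\<alpha>..\<beta>}" for t
      using tangent[OF d(3) that] curvature[OF d(3) that] root by (auto simp: R_def)
    have e: "- S u v * D = v * R u + - u * R v"
      using secant[OF u v] by (simp add: D_def R_def algebra_simps)
    have "0 \<le> v * R u + - u * R v"
      using R[OF d(1)] R[OF d(2)] u v by (intro add_nonneg_nonneg mult_nonneg_nonneg) auto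
    then have "0 \<le> - S u v * D" unfolding e .
    then have s0: "S u v \<le> 0" using Dp unfolding zero_le_mult_iff by linarith
    have "0 \<le> m * - u * (v - u)" using u l pos by (intro mult_nonneg_nonneg) auto
    then have "0 \<le> (S u v - u) * D" using low by linarith
    then have su: "u \<le> S u v" using Dp by (simp add: zero_le_mult_iff)
    have "m * - S u v * (v - u) \<le> - S u v * D"
      using mult_left_mono[OF D(1), of "- S u v"] s0 by (simp add: algebra_simps)
    also have "\<dots> \<le> v * (K * u\<^sup>2) + - u * (K * v\<^sup>2)"
      unfolding e using R[OF d(1)] R[OF d(2)] u v by (intro add_mono mult_left_mono) auto
    \<comment> \<open>The common factor v - u cancels against the one from
      \<open>D \<ge> m * (v - u)\<close>, which leaves the product of |u| and v.\<close>
    also have "\<dots> = (K * - u * v) * (v - u)" by (simp add: algebra_simps power2_eq_square)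
    finally have t: "m * - S u v \<le> K * - u * v" using l by (simp add: mult_le_cancel_right)
    have "m * - u * (v - u) \<le> (S u v - u) * (M * (v - u))"
      using low mult_left_mono[OF D(2), of "S u v - u"] su by linarith
    then have "(m * - u) * (v - u) \<le> ((S u v - u) * M) * (v - u)" by (simp add: mult.assoc)
    then have "m * - u \<le> (S u v - u) * M" using l by (simp only: mult_le_cancel_right_pos)
    then have "- S u v \<le> (1 - m / M) * - u" using consts_pos by (simp add: field_simps)
    with s0 su t show ?thesis by auto
  qed
  then show "S u v \<in> {u..0}" "m * - S u v \<le> K * - u * v" "- S u v \<le> (1 - m / M) * - u" by auto
qed

section \<open>Limits and rate of the iterated steps\<close>

lemma contraction_tendsto_0:
  assumes "\<And>i. u i \<le> 0" "\<And>i. - u (Suc i) \<le> (1 - m / M) * - u i"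
  shows "u \<longlonglongrightarrow> 0"
proof -
  define r where "r = 1 - m / M"
  have r: "0 \<le> r" "r < 1" using m_le_M consts_pos pos by (auto simp: r_def field_simps)
  have "- u i \<le> r ^ i * - u 0" for i
  proof (induction i)
    case (Suc i)
    then have "r * - u i \<le> r * (r ^ i * - u 0)" using r by (intro mult_left_mono) auto
    then show ?case using assms(2)[of i] by (simp add: r_def mult.assoc)
  qed simp
  then have b: "\<bar>u i\<bar> \<le> r ^ i * - u 0" for i using abs_of_nonpos[OF assms(1)[of i]] by metis
  have "(\<lambda>i. r ^ i) \<longlonglongrightarrow> 0" using r by (intro LIMSEQ_power_zero) simp
  then have "(\<lambda>i. r ^ i * - u 0) \<longlonglongrightarrow> 0" by (rule tendsto_mult_left_zero)
  moreover have "norm (u i) \<le> norm (r ^ i * - u 0) * 1" for i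
    using order_trans[OF b abs_ge_self] by (simp only: real_norm_def mult_1_right)
  ultimately show ?thesis by (rule tendsto_0_le[OF _ always_eventually, OF _ allI])
qed

lemma newton_tendsto_0:
  assumes "\<And>i. u i \<in> {\<alpha>..0}" "u \<longlonglongrightarrow> 0"
  shows "(\<lambda>i. N (u i)) \<longlonglongrightarrow> 0"
proof (rule tendsto_sandwich[of "\<lambda>_. 0" _ _ "\<lambda>i. K / m * (u i)\<^sup>2"])
  have "(\<lambda>i. K / m * (u i)\<^sup>2) \<longlonglongrightarrow> K / m * 0\<^sup>2"
    by (intro tendsto_intros assms)
  then show "(\<lambda>i. K / m * (u i)\<^sup>2) \<longlonglongrightarrow> 0" by simp
  show "\<forall>\<^sub>F i in sequentially. N (u i) \<le> K / m * (u i)\<^sup>2"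
    using newton_bounds(3)[OF assms(1)] pos by (simp add: field_simps)
qed (use newton_bounds(1)[OF assms(1)] in auto)

text \<open>The right end stays at \<beta> while secant steps drive \<open>g\<close> to 0. The
  Newton points then tend to 0 from the right, so they finally drop below \<beta> if \<beta> >
  0.\<close>

lemma stage1:
  assumes "g 0 = \<alpha>" "\<And>j. g j \<in> {\<alpha>..0} \<Longrightarrow> g (Suc j) = S (g j) \<beta>"
  shows "g j \<in> {\<alpha>..0}" "\<exists>j. N (g j) \<in> {\<alpha>..\<beta>}"
proof -
  have b: "\<beta> \<in> {0..\<beta>}" using dom by auto
  have g: "g j \<in> {\<alpha>..0}" for j
  proof (induction j)
    case (Suc j)
    then show ?case using secant_bounds(1)[OF Suc b] assms(2)[OF Suc] by auto
  qed (use assms dom in auto)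
  then show "g j \<in> {\<alpha>..0}" .
  have ge: "\<alpha> \<le> N (g j)" for j using newton_bounds(1)[OF g[of j]] dom by linarith
  show "\<exists>j. N (g j) \<in> {\<alpha>..\<beta>}"
  proof (cases "\<beta> = 0")
    case True
    \<comment> \<open>With the root at the right end the limit argument gives nothing, but the
      product bound vanishes at v = 0, so the first secant step hits the root.\<close>
    have "m * - g 1 \<le> 0" using secant_bounds(2)[OF g[of 0] b] assms(2)[OF g[of 0]] True by simp
    then have "g 1 = 0" using pos g[of 1] by (simp add: zero_le_mult_iff)
    then have "N (g 1) = 0" by (simp add: N_def root)
    then show ?thesis using dom by (intro exI[of _ 1]) auto
  next
    case False
    then have "0 < \<beta>" using dom by auto
    have "g \<longlonglongrightarrow> 0"
      using contraction_tendsto_0[of g] g secant_bounds(3)[OF g b] assms(2)[OF g] by simp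
    from newton_tendsto_0[OF g this] have "\<forall>\<^sub>F j in sequentially. N (g j) < \<beta>"
      using \<open>0 < \<beta>\<close> by (rule order_tendstoD)
    then obtain j where "N (g j) < \<beta>" by (auto simp: eventually_sequentially)
    then show ?thesis using ge[of j] by (intro exI[of _ j]) auto
  qed
qed

text \<open>Nothing is assumed of \<open>x 0\<close>, an end of the initial interval; every later x
  is a Newton point, and the rate estimate therefore starts at i = 1.\<close>

lemma stage2:
  fixes x c :: "nat \<Rightarrow> real"
  assumes c0: "c 0 \<in> {\<alpha>..0}" "N (c 0) \<le> \<beta>"
    and x: "\<And>i. x (Suc i) = N (c i)"
    and c: "\<And>i. c i \<in> {\<alpha>..0} \<Longrightarrow> x (Suc i) \<in> {0..\<beta>} \<Longrightarrow> c (Suc i) = S (c i) (x (Suc i))"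
  shows "x \<longlonglongrightarrow> 0" "c \<longlonglongrightarrow> 0"
    "\<exists>C. \<forall>i\<ge>1. \<bar>x (Suc i) - c (Suc i)\<bar> \<le> C * \<bar>x i - c i\<bar> ^ 3"
proof -
  have "c i \<in> {\<alpha>..0} \<and> x (Suc i) \<in> {0..\<beta>}" for i
  proof (induction i)
    case 0
    then show ?case using c0 x newton_bounds(1) by simp
  next
    case (Suc i)
    then have ci: "c i \<in> {\<alpha>..0}" and xi: "x (Suc i) \<in> {0..\<beta>}" by auto
    have s: "c (Suc i) \<in> {c i..0}" using secant_bounds(1)[OF ci xi] c[OF ci xi] by simp
    then have s': "c (Suc i) \<in> {\<alpha>..0}" using ci by auto
    \<comment> \<open>The left points move towards 0, so the Newton points decrease and the initial
      bound by \<beta> persists.\<close>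
    have "N (c (Suc i)) \<le> N (c i)" using newton_antimono[OF ci s'] s by auto
    then show ?case using s' x[of i] x[of "Suc i"] xi newton_bounds(1)[OF s'] by auto
  qed
  then have ci: "\<And>i. c i \<in> {\<alpha>..0}" and xi: "\<And>i. x (Suc i) \<in> {0..\<beta>}" by auto
  note cS = c[OF ci xi]
  show c_lim: "c \<longlonglongrightarrow> 0"
    using contraction_tendsto_0[of c] ci secant_bounds(3)[OF ci xi] cS by simp
  have "(\<lambda>i. x (Suc i)) \<longlonglongrightarrow> 0" unfolding x by (rule newton_tendsto_0[OF ci c_lim])
  then show "x \<longlonglongrightarrow> 0" by (rule LIMSEQ_imp_Suc)
  define A B where "A = K / m" and "B = M / k"
  have AB: "0 < A" "0 < B" using consts_pos pos by (auto simp: A_def B_def)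
  have step: "(c i)\<^sup>2 \<le> B * x (Suc i)" "x (Suc i) \<le> A * (c i)\<^sup>2" "- c (Suc i) \<le> A * - c i * x (Suc i)" for i
  proof -
    have "k * (c i)\<^sup>2 \<le> M * x (Suc i)" "m * x (Suc i) \<le> K * (c i)\<^sup>2"
      using newton_bounds(2,3)[OF ci[of i]] by (simp_all only: x)
    moreover have "m * - c (Suc i) \<le> K * - c i * x (Suc i)"
      using secant_bounds(2)[OF ci xi, of i i] by (simp only: cS)
    ultimately show "(c i)\<^sup>2 \<le> B * x (Suc i)" "x (Suc i) \<le> A * (c i)\<^sup>2" "- c (Suc i) \<le> A * - c i * x (Suc i)"
      using pos by (simp_all add: A_def B_def field_simps)
  qed
  \<comment> \<open>The first factor bounds the whole length by x(i+1), as |c(i+1)| is at most -A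
    \<alpha> x(i+1). In the second, one \<open>A\<close> comes from the Newton step, two from the
    squared secant step, and \<open>B\<close> from the lower Newton bound.\<close>
  define C where "C = (1 + A * - \<alpha>) * (A ^ 3 * B)"
  have A\<alpha>: "0 \<le> 1 + A * - \<alpha>" using AB dom mult_nonneg_nonneg[of A "- \<alpha>"] by linarith
  then have C: "0 \<le> C" using AB unfolding C_def by (intro mult_nonneg_nonneg) auto
  have "\<bar>x (Suc i) - c (Suc i)\<bar> \<le> C * \<bar>x i - c i\<bar> ^ 3" if i: "i \<ge> 1" for i
  proof -
    obtain j where j: "i = Suc j" using i by (cases i) auto
    have xp: "0 \<le> x i" "0 \<le> x (Suc i)" using xi[of j] xi[of i] j by auto
    have cp: "0 \<le> - c i" "- c i \<le> - \<alpha>" "0 \<le> - c (Suc i)" using ci[of i] ci[of "Suc i"] by auto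
    have "(- c i) ^ 2 \<le> (A * - c j * x i) ^ 2"
      using step(3)[of j] j cp by (intro power_mono) auto
    also have "\<dots> = A\<^sup>2 * (c j)\<^sup>2 * (x i)\<^sup>2" by (simp add: power_mult_distrib)
    \<comment> \<open>Here \<open>x i\<close> is the Newton point of \<open>c j\<close>; trading the
      square of \<open>c j\<close> for \<open>x i\<close> raises the power of \<open>x i\<close>
      from 2 to 3.\<close>
    also have "\<dots> \<le> A\<^sup>2 * (B * x i) * (x i)\<^sup>2"
      using step(1)[of j] j AB by (intro mult_right_mono mult_left_mono) auto
    also have "\<dots> = A\<^sup>2 * B * x i ^ 3" by (simp add: power2_eq_square power3_eq_cube)
    finally have "(c i)\<^sup>2 \<le> A\<^sup>2 * B * x i ^ 3" by simp
    then have "A * (c i)\<^sup>2 \<le> A * (A\<^sup>2 * B * x i ^ 3)" using AB by (intro mult_left_mono) auto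
    then have x3: "x (Suc i) \<le> A ^ 3 * B * x i ^ 3"
      using step(2)[of i] by (simp add: power2_eq_square power3_eq_cube algebra_simps)
    have "A * - c i * x (Suc i) \<le> A * - \<alpha> * x (Suc i)"
      using cp xp AB by (intro mult_right_mono mult_left_mono) auto
    then have "x (Suc i) - c (Suc i) \<le> (1 + A * - \<alpha>) * x (Suc i)"
      using step(3)[of i] by (simp add: algebra_simps)
    also have "\<dots> \<le> (1 + A * - \<alpha>) * (A ^ 3 * B * x i ^ 3)"
      using x3 A\<alpha> by (rule mult_left_mono)
    also have "\<dots> = C * x i ^ 3" by (simp add: C_def)
    also have "\<dots> \<le> C * (x i - c i) ^ 3"
      using xp cp C by (intro mult_left_mono power_mono) auto
    finally show ?thesis using xp cp by simp
  qed
  then show "\<exists>C. \<forall>i\<ge>1. \<bar>x (Suc i) - c (Suc i)\<bar> \<le> C * \<bar>x i - c i\<bar> ^ 3" by blast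
qed

end

section \<open>Polynomials without critical points and inflection points on an interval\<close>

text \<open>By the intermediate value theorem a change of sign against \<open>A\<close> would
  produce a zero.\<close>

lemma poly_sgn_const:
  fixes p :: "real poly"
  assumes "\<And>t. t \<in> {A..B} \<Longrightarrow> poly p t \<noteq> 0" "t \<in> {A..B}"
  shows "0 < sgn (poly p A) * poly p t"
proof (rule ccontr)
  assume n: "\<not> ?thesis"
  have "poly p A \<noteq> 0" "poly p t \<noteq> 0" using assms by auto
  with n have neg: "poly p A * poly p t < 0"
    by (auto simp: sgn_if mult_less_0_iff split: if_splits)
  then have "A < t" using assms(2) by (cases "A = t") (auto simp: not_square_less_zero)
  from poly_IVT[OF this neg] obtain z where "A < z" "z < t" "poly p z = 0" by auto
  then show False using assms(1)[of z] assms(2) by auto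
qed

text \<open>The minimum is attained on the compact interval, hence strictly positive.\<close>

lemma poly_bounds:
  fixes p :: "real poly"
  assumes "A \<le> B" "\<And>t. t \<in> {A..B} \<Longrightarrow> 0 < \<sigma> * poly p t"
  obtains l h where "0 < l" "l \<le> h" "\<And>t. t \<in> {A..B} \<Longrightarrow> l \<le> \<sigma> * poly p t \<and> \<sigma> * poly p t \<le> h"
proof -
  have c: "\<forall>t. A \<le> t \<and> t \<le> B \<longrightarrow> isCont (\<lambda>t. \<sigma> * poly p t) t" by (auto intro!: continuous_intros)
  obtain l where l: "\<forall>t. A \<le> t \<and> t \<le> B \<longrightarrow> \<sigma> * poly p l \<le> \<sigma> * poly p t" "A \<le> l" "l \<le> B"
    using isCont_eq_Lb[OF assms(1) c] by blast
  obtain h where h: "\<forall>t. A \<le> t \<and> t \<le> B \<longrightarrow> \<sigma> * poly p t \<le> \<sigma> * poly p h"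
    using isCont_eq_Ub[OF assms(1) c] by blast
  show ?thesis
    by (rule that[of "\<sigma> * poly p l" "\<sigma> * poly p h"]) (use l h assms in auto)
qed

text \<open>This is the Lagrange form of the remainder; the case u = w is split off because
  \<open>Taylor\<close> needs distinct points.\<close>

lemma poly_taylor2:
  fixes p :: "real poly"
  assumes "u \<in> {A..B}" "w \<in> {A..B}"
  obtains t where "t \<in> {A..B}"
    "poly p w - poly p u - poly (pderiv p) u * (w - u) = poly (pderiv (pderiv p)) t / 2 * (w - u)\<^sup>2"
proof (cases "u = w")
  case True
  with assms that show ?thesis by auto
next
  case False
  define d where "d n = poly ((pderiv ^^ n) p)" for n
  have "\<forall>n t. n < 2 \<and> A \<le> t \<and> t \<le> B \<longrightarrow> DERIV (d n) t :> d (Suc n) t"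
    unfolding d_def by (auto intro!: poly_DERIV)
  with False assms have "\<exists>t. (if w < u then w < t \<and> t < u else u < t \<and> t < w) \<and>
     poly p w = (\<Sum>n<2. d n u / fact n * (w - u) ^ n) + d 2 t / fact 2 * (w - u) ^ 2"
    by (intro Taylor[where a = A and b = B]) (auto simp: d_def)
  then obtain t where "if w < u then w < t \<and> t < u else u < t \<and> t < w"
    "poly p w = (\<Sum>n<2. d n u / fact n * (w - u) ^ n) + d 2 t / fact 2 * (w - u) ^ 2" by blast
  then show ?thesis using assms by (intro that[of t]) (auto simp: d_def numeral_2_eq_2 split: if_splits)
qed

text \<open>Stage 1 names the fixed end first, whereas \<open>S\<close> takes the left point
  first.\<close>

lemma secant_step_commute: "secant_step p u v = secant_step p v u"
  unfolding secant_step_def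
  using minus_divide_divide[of "u * poly p v - v * poly p u" "poly p v - poly p u"] by simp

section \<open>Reduction to the increasing convex case\<close>

text \<open>The nonvanishing of both derivatives is what a monotonic convex isolation supplies on a
  nondegenerate interval.\<close>

theorem lz2_convergence:
  fixes p :: "real poly" and A B \<xi> :: real
  assumes AB: "A \<le> B" and xi: "\<xi> \<in> {A..B}" "poly p \<xi> = 0"
    and p1: "\<And>t. t \<in> {A..B} \<Longrightarrow> poly (pderiv p) t \<noteq> 0"
    and p2: "\<And>t. t \<in> {A..B} \<Longrightarrow> poly (pderiv (pderiv p)) t \<noteq> 0"
  shows "lz2_converges_to p A B \<xi> \<and> convergence_rate_at_least (\<lambda>i. \<bar>lz2_x p A B i - lz2_c p A B i\<bar>) 3"
proof -
  define \<tau> where "\<tau> = sgn (poly (pderiv p) A)"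
  define \<sigma> where "\<sigma> = sgn (poly (pderiv (pderiv p)) A)"
  \<comment> \<open>With q(t) = \<sigma> p(\<xi> + s t) the second derivative is \<sigma> p'',
    because s squared is 1, and the first is \<sigma> s p'. This choice of s turns the latter into
    \<tau> p', so both are positive.\<close>
  define s where "s = \<sigma> * \<tau>"
  have sq: "\<sigma> * \<sigma> = 1" "\<tau> * \<tau> = 1"
    using p1[of A] p2[of A] AB by (auto simp: \<sigma>_def \<tau>_def sgn_if)
  then have ss: "s * s = 1" by (simp add: s_def algebra_simps)
  then have s_cases: "s = 1 \<or> s = -1" by (simp add: square_eq_1_iff)
  have \<sigma>s: "\<sigma> * s = \<tau>" using sq by (simp add: s_def flip: mult.assoc)
  have nz: "\<sigma> \<noteq> 0" "\<tau> \<noteq> 0" "s \<noteq> 0" using sq ss by auto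
  have "\<And>t. t \<in> {A..B} \<Longrightarrow> 0 < \<tau> * poly (pderiv p) t"
    unfolding \<tau>_def by (rule poly_sgn_const[OF p1])
  from poly_bounds[OF AB this] obtain m M where m: "0 < m" "m \<le> M"
    "\<And>t. t \<in> {A..B} \<Longrightarrow> m \<le> \<tau> * poly (pderiv p) t \<and> \<tau> * poly (pderiv p) t \<le> M"
    by blast
  have "\<And>t. t \<in> {A..B} \<Longrightarrow> 0 < \<sigma> * poly (pderiv (pderiv p)) t"
    unfolding \<sigma>_def by (rule poly_sgn_const[OF p2])
  from poly_bounds[OF AB this] obtain k K where k: "0 < k" "k \<le> K"
    "\<And>t. t \<in> {A..B} \<Longrightarrow> k \<le> \<sigma> * poly (pderiv (pderiv p)) t \<and> \<sigma> * poly (pderiv (pderiv p)) t \<le> K"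
    by blast
  \<comment> \<open>The ends of the image of [A, B] under y \<mapsto> s (y - \<xi>); a reflection
    swaps them.\<close>
  define \<alpha> where "\<alpha> = (if s = 1 then A - \<xi> else \<xi> - B)"
  define \<beta> where "\<beta> = (if s = 1 then B - \<xi> else \<xi> - A)"
  define q where "q t = \<sigma> * poly p (\<xi> + s * t)" for t
  define q' where "q' t = \<tau> * poly (pderiv p) (\<xi> + s * t)" for t
  define S where "S u v = s * (secant_step p (\<xi> + s * u) (\<xi> + s * v) - \<xi>)" for u v
  have mem_iff: "\<xi> + s * t \<in> {A..B} \<longleftrightarrow> t \<in> {\<alpha>..\<beta>}" for t
    using s_cases by (auto simp: \<alpha>_def \<beta>_def)
  have inv: "\<xi> + s * (s * (y - \<xi>)) = y" for y
    using ss by (simp flip: mult.assoc)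
  have curv: "k / 2 * (w - u)\<^sup>2 \<le> q w - q u - q' u * (w - u) \<and> q w - q u - q' u * (w - u) \<le> K / 2 * (w - u)\<^sup>2"
    if uw: "u \<in> {\<alpha>..\<beta>}" "w \<in> {\<alpha>..\<beta>}" for u w
  proof -
    obtain t where t: "t \<in> {A..B}"
      "poly p (\<xi> + s * w) - poly p (\<xi> + s * u) - poly (pderiv p) (\<xi> + s * u) * ((\<xi> + s * w) - (\<xi> + s * u))
        = poly (pderiv (pderiv p)) t / 2 * ((\<xi> + s * w) - (\<xi> + s * u))\<^sup>2"
      using poly_taylor2 uw mem_iff by metis
    have "((\<xi> + s * w) - (\<xi> + s * u))\<^sup>2 = s * s * (w - u)\<^sup>2"
      by (simp add: power2_eq_square algebra_simps)
    then have sqr: "((\<xi> + s * w) - (\<xi> + s * u))\<^sup>2 = (w - u)\<^sup>2" by (simp add: ss)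
    have "q w - q u - q' u * (w - u)
        = \<sigma> * (poly p (\<xi> + s * w) - poly p (\<xi> + s * u) - poly (pderiv p) (\<xi> + s * u) * ((\<xi> + s * w) - (\<xi> + s * u)))"
      unfolding q_def q'_def \<sigma>s[symmetric] by (simp add: algebra_simps)
    also have "\<dots> = (\<sigma> * poly (pderiv (pderiv p)) t) / 2 * (w - u)\<^sup>2"
      unfolding t(2) sqr by simp
    finally have e: "q w - q u - q' u * (w - u) = (\<sigma> * poly (pderiv (pderiv p)) t) / 2 * (w - u)\<^sup>2" .
    show ?thesis unfolding e using k(3)[OF t(1)]
      by (intro conjI mult_right_mono divide_right_mono) auto
  qed
  have \<alpha>\<beta>: "\<alpha> \<le> 0" "0 \<le> \<beta>" using xi by (auto simp: \<alpha>_def \<beta>_def)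
  have slope: "m \<le> q' t \<and> q' t \<le> M" if "t \<in> {\<alpha>..\<beta>}" for t
    using m(3) that mem_iff by (auto simp: q'_def)
  have q_inj: "q u < q v" if "u \<in> {\<alpha>..\<beta>}" "v \<in> {\<alpha>..\<beta>}" "u < v" for u v
  proof -
    have "0 < q' u * (v - u)" using slope[OF that(1)] that m(1) by (intro mult_pos_pos) auto
    moreover have "0 \<le> k / 2 * (v - u)\<^sup>2" using k(1) by simp
    ultimately show ?thesis using curv[OF that(1,2)] by linarith
  qed
  \<comment> \<open>The secant step commutes with affine changes of variable, and scaling
    \<open>p\<close> by \<sigma> does not alter it.\<close>
  have secant: "S u v * (q v - q u) = u * q v - v * q u" if uv: "u \<in> {\<alpha>..0}" "v \<in> {0..\<beta>}" for u v
  proof (cases "u = v")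
    case False
    then have "q u \<noteq> q v" using q_inj[of u v] uv \<alpha>\<beta> by auto
    then have n: "poly p (\<xi> + s * v) - poly p (\<xi> + s * u) \<noteq> 0" by (auto simp: q_def)
    have "secant_step p (\<xi> + s * u) (\<xi> + s * v) * (poly p (\<xi> + s * v) - poly p (\<xi> + s * u))
        = (\<xi> + s * u) * poly p (\<xi> + s * v) - (\<xi> + s * v) * poly p (\<xi> + s * u)"
      using n False nz by (simp add: secant_step_def)
    then have "(secant_step p (\<xi> + s * u) (\<xi> + s * v) - \<xi>) * (poly p (\<xi> + s * v) - poly p (\<xi> + s * u))
        = s * (u * poly p (\<xi> + s * v) - v * poly p (\<xi> + s * u))"
      by (simp add: algebra_simps)
    then have "S u v * (poly p (\<xi> + s * v) - poly p (\<xi> + s * u))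
        = s * s * (u * poly p (\<xi> + s * v) - v * poly p (\<xi> + s * u))"
      by (simp add: S_def mult.assoc)
    then have "\<sigma> * (S u v * (poly p (\<xi> + s * v) - poly p (\<xi> + s * u)))
        = \<sigma> * (u * poly p (\<xi> + s * v) - v * poly p (\<xi> + s * u))" by (simp add: ss)
    then show ?thesis by (simp add: q_def algebra_simps)
  qed simp
  \<comment> \<open>The halves come from the factor 1/2 in the Taylor remainder.\<close>
  interpret newton_secant q q' S \<alpha> \<beta> m M "k / 2" "K / 2"
  proof
    show "q 0 = 0" using xi by (simp add: q_def)
    show "S 0 0 = 0" by (simp add: S_def secant_step_def)
  qed (use \<alpha>\<beta> m(1) k(1,2) slope curv secant in auto)
  have newton: "newton_step p y = \<xi> + s * N (s * (y - \<xi>))" for y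
  proof -
    have "N (s * (y - \<xi>)) = s * (y - \<xi>) - (\<sigma> * poly p y) / (\<tau> * poly (pderiv p) y)"
      unfolding N_def q_def q'_def inv ..
    also have "(\<sigma> * poly p y) / (\<tau> * poly (pderiv p) y) = s * (poly p y / poly (pderiv p) y)"
    proof -
      have "\<sigma> / \<tau> = s" using sq nz by (simp add: s_def field_simps)
      then show ?thesis by (metis times_divide_times_eq)
    qed
    finally have e: "N (s * (y - \<xi>)) = s * (y - \<xi>) - s * (poly p y / poly (pderiv p) y)" .
    have "s * N (s * (y - \<xi>)) = s * s * (y - \<xi>) - s * s * (poly p y / poly (pderiv p) y)"
      unfolding e by (simp only: right_diff_distrib mult.assoc)
    then show ?thesis by (simp add: newton_step_def ss)
  qed

  \<comment> \<open>Stage 1 in the normalised coordinate\<close>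
  define g where "g j = s * (lz2_gamma p A B j - \<xi>)" for j
  have stop_iff: "lz2_stage1_stop p A B j \<longleftrightarrow> N (g j) \<in> {\<alpha>..\<beta>}" for j
    unfolding lz2_stage1_stop_def newton g_def by (rule mem_iff)
  define J where "J = (LEAST j. lz2_stage1_stop p A B j)"
  have J: "(\<exists>j. lz2_stage1_stop p A B j) \<and> g J \<in> {\<alpha>..0}"
  \<comment> \<open>If the root is \<open>A\<close>, then \<open>p(A) p''(A) = 0\<close> starts with \<open>(B, A)\<close> whatever the signs of the derivatives, and
    the start need not be \<open>(\<beta>, \<alpha>)\<close> in the coordinate \<open>t\<close>.\<close>
  proof (cases "snd (lz2_start p A B) = \<xi>")
    case True
    then have g0: "g 0 = 0" by (simp add: g_def)
    then have "N (g 0) = 0" using root by (simp add: N_def)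
    then have "lz2_stage1_stop p A B 0" using stop_iff \<alpha>\<beta> by simp
    moreover from this have "J = 0" unfolding J_def by (intro Least_eq_0)
    ultimately show ?thesis using g0 \<alpha>\<beta> by auto
  next
    case False
    have sA: "poly (pderiv (pderiv p)) A = \<sigma> * \<bar>poly (pderiv (pderiv p)) A\<bar>"
      by (simp add: \<sigma>_def sgn_mult_abs)
    have nA: "0 < \<bar>poly (pderiv (pderiv p)) A\<bar>" using p2[of A] AB by simp
    have "poly p A = \<sigma> * q (s * (A - \<xi>))" unfolding q_def inv using sq by (simp flip: mult.assoc)
    then have "poly p A * poly (pderiv (pderiv p)) A
        = \<sigma> * \<sigma> * (q (s * (A - \<xi>)) * \<bar>poly (pderiv (pderiv p)) A\<bar>)"
      by (subst sA) (simp add: algebra_simps)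
    \<comment> \<open>The test in \<open>lz2_start\<close> thus asks whether \<open>A\<close> is
      mapped to the side where q > 0, which is where x has to start.\<close>
    then have start_iff: "poly p A * poly (pderiv (pderiv p)) A > 0 \<longleftrightarrow> 0 < q (s * (A - \<xi>))"
      using nA sq by (simp add: zero_less_mult_iff)
    have start: "lz2_start p A B = (\<xi> + s * \<beta>, \<xi> + s * \<alpha>)"
    proof (cases "s = 1")
      case True
      have "\<not> 0 < q (s * (A - \<xi>))"
        using q_inj[of "A - \<xi>" 0] root xi True by (cases "A = \<xi>") (auto simp: \<alpha>_def \<beta>_def)
      then show ?thesis using True by (simp add: lz2_start_def start_iff \<alpha>_def \<beta>_def)
    next
      case sn: False
      then have sm: "s = - 1" using s_cases by simp
      \<comment> \<open>The test is strict, so A = \<xi> would make \<gamma>_0 the root, a case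
        already settled.\<close>
      have "A \<noteq> \<xi>"
      proof
        assume "A = \<xi>"
        then have "snd (lz2_start p A B) = \<xi>" using xi by (simp add: lz2_start_def)
        with False show False ..
      qed
      then have "0 < q (s * (A - \<xi>))"
        using q_inj[of 0 "\<xi> - A"] root xi sm by (auto simp: \<alpha>_def \<beta>_def)
      then show ?thesis using sm by (simp add: lz2_start_def start_iff \<alpha>_def \<beta>_def)
    qed
    have g0: "g 0 = \<alpha>" using ss by (simp add: g_def start flip: mult.assoc)
    have gS: "g (Suc j) = S (g j) \<beta>" for j
      by (simp add: S_def start g_def inv secant_step_commute[of p "\<xi> + s * \<beta>"])
    have "g J \<in> {\<alpha>..0}" "\<exists>j. lz2_stage1_stop p A B j"
      unfolding stop_iff by (rule stage1[of g, OF g0 gS])+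
    then show ?thesis by blast
  qed
  then have "lz2_stage1_stop p A B J" unfolding J_def by (auto intro: LeastI_ex)
  then have NJ: "N (g J) \<le> \<beta>" unfolding stop_iff by simp

  \<comment> \<open>Stage 2 in the normalised coordinate\<close>
  define x where "x i = s * (lz2_x p A B i - \<xi>)" for i
  define c where "c i = s * (lz2_c p A B i - \<xi>)" for i
  have x_eq: "lz2_x p A B i = \<xi> + s * x i" and c_eq: "lz2_c p A B i = \<xi> + s * c i" for i
    by (simp_all add: x_def c_def inv)
  have c0: "c 0 = g J" by (simp add: c_def g_def lz2_c_def J_def)
  have lx: "lz2_x p A B (Suc i) = newton_step p (lz2_c p A B i)" for i
    by (simp add: lz2_x_def lz2_c_def Let_def)
  have lc: "lz2_c p A B (Suc i) = secant_step p (lz2_c p A B i) (lz2_x p A B (Suc i))" for i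
    by (simp add: lz2_x_def lz2_c_def Let_def)
  have xS: "x (Suc i) = N (c i)" for i
    unfolding x_def lx newton c_def using ss by (simp flip: mult.assoc)
  have cS: "c (Suc i) = S (c i) (x (Suc i))" for i
    unfolding S_def c_def inv x_eq[symmetric] lc[symmetric] ..
  have lims: "x \<longlonglongrightarrow> 0" "c \<longlonglongrightarrow> 0"
    and rate: "\<exists>C. \<forall>i\<ge>1. \<bar>x (Suc i) - c (Suc i)\<bar> \<le> C * \<bar>x i - c i\<bar> ^ 3"
    using stage2[of c x, OF _ _ xS cS] J NJ c0 by auto
  have conv: "lz2_x p A B \<longlonglongrightarrow> \<xi>" "lz2_c p A B \<longlonglongrightarrow> \<xi>"
  proof -
    have "(\<lambda>i. \<xi> + s * x i) \<longlonglongrightarrow> \<xi> + s * 0" "(\<lambda>i. \<xi> + s * c i) \<longlonglongrightarrow> \<xi> + s * 0"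
      by (intro tendsto_intros lims)+
    then show "lz2_x p A B \<longlonglongrightarrow> \<xi>" "lz2_c p A B \<longlonglongrightarrow> \<xi>"
      by (simp_all add: x_eq[symmetric] c_eq[symmetric])
  qed
  have len: "\<bar>lz2_x p A B i - lz2_c p A B i\<bar> = \<bar>x i - c i\<bar>" for i
    using s_cases by (auto simp: x_eq c_eq)
  have "(\<lambda>i. \<bar>x i - c i\<bar>) \<longlonglongrightarrow> \<bar>0 - 0\<bar>" by (intro tendsto_intros lims)
  \<comment> \<open>On nonnegative lengths \<open>powr 3\<close> is the cube, and index 1 serves as
    the threshold.\<close>
  then have "convergence_rate_at_least (\<lambda>i. \<bar>lz2_x p A B i - lz2_c p A B i\<bar>) 3"
    using rate unfolding convergence_rate_at_least_def len
    by (auto simp: eventually_sequentially)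
  then show ?thesis using J conv by (simp add: lz2_converges_to_def)
qed

section \<open>Application to an interval of the isolation\<close>

theorem theorem5p4:
  fixes f :: "rat poly" and a b :: rat and Iso :: "(rat \<times> rat) set" and \<xi> :: real
  assumes "degree f > 0"
    and "squarefree f"
    and "monotonic_convex_isolation f Iso"
    and "(a, b) \<in> Iso"
    and "a < b"
    and "a * b > 0"
    and "\<xi> \<in> {real_of_rat a .. real_of_rat b}"
    and "poly (real_poly f) \<xi> = 0"
  shows "lz2_converges_to (real_poly f) (real_of_rat a) (real_of_rat b) \<xi>
       \<and> convergence_rate_at_least
           (\<lambda>i. \<bar>lz2_x (real_poly f) (real_of_rat a) (real_of_rat b) i
                 - lz2_c (real_poly f) (real_of_rat a) (real_of_rat b) i\<bar>) 3"
proof (rule lz2_convergence)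
  show "real_of_rat a \<le> real_of_rat b" using assms(5) by (simp add: of_rat_less_eq)
qed (use assms(3,4,5,7,8) in \<open>auto simp: monotonic_convex_isolation_def\<close>)

end
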